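(* Let $m$ be a positive integer and suppose $J,K\subseteq\{0,1,\ldots,m-1\}$ with $|J|=|K|=2$. Then $H_{J,K}$ is a Hadamard submatrix of $\mathcal{F}_m$ if and only if $$\nu_2^{\min}(\mathcal{P}_m(J)\setminus\{1\})+\nu_2^{\min}(\mathcal{P}_m(K)\setminus\{1\})=\nu_2^{\max}(\mathcal{P}_m(J)\setminus\{1\})+\nu_2^{\max}(\mathcal{P}_m(K)\setminus\{1\})=\nu_2(m)+1$$ and $$\nu_p^{\max}(\mathcal{P}_m(J)\setminus\{1\})+\nu_p^{\max}(\mathcal{P}_m(K)\setminus\{1\})\leq\nu_p(m)$$ for all odd primes $p$.
   Context: $\mathcal{F}_m=(e^{2\pi i jk/m})_{0\le j,k\le m-1}$ is the $m\times m$ Fourier matrix. For $J,K\subseteq\{0,\ldots,m-1\}$ with $|J|=|K|=n$, $H_{J,K}=H_{J,K,m}=(e^{2\pi i jk/m})_{j\in J,k\in K}$ is the $n\times n$ submatrix of $\mathcal{F}_m$ with rows $J$ and columns $K$ (each listed in increasing order). An $n\times n$ complex matrix $H$ is Hadamard if all its entries have modulus $1$ and $H^*H=HH^*=nI_n$. For a nonempty finite set $X$ of nonnegative integers, $\mathcal{D}(X)=\{x_1-x_2:x_1,x_2\in X\}$ and $\mathcal{P}_m(X)=\left\{\frac{m}{\gcd(m,d)}:d\in\mathcal{D}(X)\right\}$ (with $\gcd(m,0)=m$). For a prime $p$ and a nonzero integer $n$, $\nu_p(n)=\max\{v\ge 0: p^v\mid n\}$; for a set $X$ of nonzero integers, $\nu_p^{\max}(X)=\max\{\nu_p(n):n\in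 X\}$ and $\nu_p^{\min}(X)=\min\{\nu_p(n):n\in X\}$. *)

theory Defs
  imports
    Complex_Main
    "HOL-Computational_Algebra.Primes"
    "Jordan_Normal_Form.Schur_Decomposition"
    "Jordan_Normal_Form.DL_Submatrix"
begin

definition fourier_mat :: "nat \<Rightarrow> complex mat" where
  "fourier_mat m = mat m m
     (\<lambda>(j, k). exp (2 * of_real pi * \<i> * of_nat j * of_nat k / of_nat m))"

(* The library's submatrix enumerates the row and column sets in increasing order (via pick). *)
definition fourier_submat :: "nat \<Rightarrow> nat set \<Rightarrow> nat set \<Rightarrow> complex mat" where
  "fourier_submat m J K = submatrix (fourier_mat m) J K"

(* mat_adjoint is the conjugate transpose. *)
definition hadamard :: "complex mat \<Rightarrow> bool" where
  "hadamard H \<longleftrightarrow> square_mat H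
     \<and> (\<forall>i < dim_row H. \<forall>j < dim_col H. cmod (H $$ (i, j)) = 1)
     \<and> mat_adjoint H * H = of_nat (dim_row H) \<cdot>\<^sub>m 1\<^sub>m (dim_row H)
     \<and> H * mat_adjoint H = of_nat (dim_row H) \<cdot>\<^sub>m 1\<^sub>m (dim_row H)"

(* Differences are taken in int, since subtraction on nat truncates. *)
definition diff_set :: "nat set \<Rightarrow> int set" where
  "diff_set X = {int x1 - int x2 | x1 x2. x1 \<in> X \<and> x2 \<in> X}"

(* The division is exact; the difference 0 contributes m div m = 1 (for m > 0). *)
definition period_set :: "nat \<Rightarrow> nat set \<Rightarrow> int set" where
  "period_set m X = {int m div gcd (int m) d | d. d \<in> diff_set X}"

(* For a prime p and nonzero n, multiplicity p n is the p-adic valuation of n.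
   The two definitions below are meant for finite nonempty sets of nonzero integers. *)
definition nu_max :: "nat \<Rightarrow> int set \<Rightarrow> nat" where
  "nu_max p X = Max (multiplicity (int p) ` X)"

definition nu_min :: "nat \<Rightarrow> int set \<Rightarrow> nat" where
  "nu_min p X = Min (multiplicity (int p) ` X)"

end

theory Submission
  imports Defs
begin

text \<open>
  Let \<open>a\<close> and \<open>b\<close> be the differences between the two elements of \<open>J\<close> and of \<open>K\<close>. For a
  two-by-two matrix with unimodular entries \<open>x, y\<close> and \<open>z, w\<close>, orthogonality of the rows and
  orthogonality of the columns both come down to the single equation \<open>x * w = - (y * z)\<close>. The
  common factors of the Fourier entries cancel from it, leaving \<open>exp (2 * pi * i * a * b / m) = -1\<close>;
  so the submatrix is Hadamard exactly when \<open>2 * a * b\<close> is an odd multiple of \<open>m\<close>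
  (\<open>hadamard_fourier_submat_iff\<close>).

  Being an odd multiple of \<open>m\<close> is a condition on valuations: \<open>2 * a * b\<close> has the same
  2-adic valuation as \<open>m\<close>, and at every odd prime at least that of \<open>m\<close> (\<open>odd_multiple_iff\<close>).
  On the other side, since \<open>a\<close> and \<open>b\<close> lie strictly between 0 and \<open>m\<close>, the sets of periods
  other than 1 are the singletons of \<open>m / gcd m a\<close> and \<open>m / gcd m b\<close>. So the minimum and the maximum
  valuations agree, and each is \<open>\<nu>(m) - min (\<nu>(m)) (\<nu>(a))\<close>, respectively with \<open>b\<close>. Truncation
  at \<open>\<nu>(m)\<close> could hide information about \<open>\<nu>(a)\<close>, but not in the ranges compared here: the valuations
  of the two periods add up to at most \<open>\<nu>(m)\<close> exactly when \<open>\<nu>(a * b) \<ge> \<nu>(m)\<close>, and to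
  \<open>\<nu>(m) + 1\<close> exactly when \<open>\<nu>(a * b) = \<nu>(m) - 1\<close>.
\<close>

section \<open>Hadamard matrices of order two\<close>

lemma mat_adjoint_mult_index:
  fixes A :: "complex mat"
  assumes "A \<in> carrier_mat n n" "i < n" "j < n"
  shows "(mat_adjoint A * A) $$ (i, j) = (\<Sum>l<n. cnj (A $$ (l, i)) * A $$ (l, j))"
    and "(A * mat_adjoint A) $$ (i, j) = (\<Sum>l<n. A $$ (i, l) * cnj (A $$ (j, l)))"
  using assms by (auto simp: mat_adjoint_def mat_of_rows_def scalar_prod_def atLeast0LessThan
      intro!: sum.cong)

text \<open>
  On the unit circle conjugation is inversion, so both off-diagonal orthogonality
  relations are the displayed equation divided by a product of entries.
\<close>

lemma hadamard_order_two_iff: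
  assumes H: "H \<in> carrier_mat 2 2"
    and unimodular: "\<And>i j. i < 2 \<Longrightarrow> j < 2 \<Longrightarrow> cmod (H $$ (i, j)) = 1"
  shows "hadamard H \<longleftrightarrow> H $$ (0, 0) * H $$ (1, 1) = - (H $$ (0, 1) * H $$ (1, 0))"
proof -
  define x y z w where "x = H $$ (0, 0)" and "y = H $$ (0, 1)"
    and "z = H $$ (1, 0)" and "w = H $$ (1, 1)"
  note entries = x_def y_def z_def w_def
  have cnj_inverse: "cnj u = 1 / u" "u \<noteq> 0" if "cmod u = 1" for u
    using that by (auto simp: complex_div_cnj[of 1 u])
  have mod1: "cmod x = 1" "cmod y = 1" "cmod z = 1" "cmod w = 1"
    unfolding entries by (simp_all add: unimodular)
  note inv = cnj_inverse(1)[OF mod1(1)] cnj_inverse(1)[OF mod1(2)]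
    cnj_inverse(1)[OF mod1(3)] cnj_inverse(1)[OF mod1(4)]
  note nz = cnj_inverse(2)[OF mod1(1)] cnj_inverse(2)[OF mod1(2)]
    cnj_inverse(2)[OF mod1(3)] cnj_inverse(2)[OF mod1(4)]
  have dims: "dim_row H = 2" "dim_col H = 2"
    "dim_row (mat_adjoint H) = 2" "dim_col (mat_adjoint H) = 2"
    using H by (auto simp: mat_adjoint_def)
  have two: "(\<forall>i<2. \<forall>j<2. P i j) \<longleftrightarrow> P 0 0 \<and> P 0 1 \<and> P 1 0 \<and> P 1 1"
    for P :: "nat \<Rightarrow> nat \<Rightarrow> bool"
    by (auto simp: less_2_cases_iff)
  have sum_two: "(\<Sum>l<2. f l) = f 0 + f 1" for f :: "nat \<Rightarrow> complex"
    by (simp add: numeral_2_eq_2)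
  have columns: "mat_adjoint H * H = 2 \<cdot>\<^sub>m 1\<^sub>m 2 \<longleftrightarrow> x * w = - (y * z)"
  proof -
    have "mat_adjoint H * H = 2 \<cdot>\<^sub>m 1\<^sub>m 2 \<longleftrightarrow>
      (\<forall>i<2. \<forall>j<2. (mat_adjoint H * H) $$ (i, j) = (if i = j then 2 else 0))"
      using dims by (auto simp: mat_eq_iff)
    also have "\<dots> \<longleftrightarrow> y / x + w / z = 0 \<and> x / y + z / w = 0"
      unfolding two using nz
      by (simp add: mat_adjoint_mult_index[OF H] sum_two inv flip: entries
          del: index_mult_mat One_nat_def)
    also have "\<dots> \<longleftrightarrow> x * w = - (y * z)"
      using nz by (auto simp: add_frac_eq eq_neg_iff_add_eq_0 mult.commute add.commute)
    finally show ?thesis .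
  qed
  have rows: "H * mat_adjoint H = 2 \<cdot>\<^sub>m 1\<^sub>m 2 \<longleftrightarrow> x * w = - (y * z)"
  proof -
    have "H * mat_adjoint H = 2 \<cdot>\<^sub>m 1\<^sub>m 2 \<longleftrightarrow>
      (\<forall>i<2. \<forall>j<2. (H * mat_adjoint H) $$ (i, j) = (if i = j then 2 else 0))"
      using dims by (auto simp: mat_eq_iff)
    also have "\<dots> \<longleftrightarrow> x / z + y / w = 0 \<and> z / x + w / y = 0"
      unfolding two using nz
      by (simp add: mat_adjoint_mult_index[OF H] sum_two inv flip: entries
          del: index_mult_mat One_nat_def)
    also have "\<dots> \<longleftrightarrow> x * w = - (y * z)"
      using nz by (auto simp: add_frac_eq eq_neg_iff_add_eq_0 mult.commute add.commute)
    finally show ?thesis .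
  qed
  have "hadamard H \<longleftrightarrow> mat_adjoint H * H = 2 \<cdot>\<^sub>m 1\<^sub>m 2 \<and> H * mat_adjoint H = 2 \<cdot>\<^sub>m 1\<^sub>m 2"
    using dims unimodular by (simp add: hadamard_def)
  then show ?thesis
    using columns rows by (simp only: entries simp_thms)
qed

section \<open>Fourier submatrices of order two\<close>

lemma cis_eq_minus_one_iff: "cis t = - 1 \<longleftrightarrow> (\<exists>n::int. t = (2 * of_int n + 1) * pi)"
proof
  assume "cis t = - 1"
  then have "cos (t - pi) = 1" by (simp add: complex_eq_iff)
  then obtain n :: int where "t - pi = of_int n * 2 * pi" unfolding cos_one_2pi_int by blast
  then show "\<exists>n::int. t = (2 * of_int n + 1) * pi"
    by (intro exI[of _ n]) (simp add: algebra_simps)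
next
  assume "\<exists>n::int. t = (2 * of_int n + 1) * pi"
  then obtain n :: int where "t - pi = of_int n * 2 * pi" by (auto simp: algebra_simps)
  then have "cos (t - pi) = 1" by (auto simp: cos_one_2pi_int)
  then have "cos t = - 1" by simp
  then show "cis t = - 1"
    using sin_cos_squared_add[of t] by (simp add: complex_eq_iff)
qed

lemma cis_turn_eq_minus_one_iff:
  fixes m c :: nat
  assumes "m > 0"
  shows "cis (2 * pi * c / m) = - 1 \<longleftrightarrow> (\<exists>q. odd q \<and> 2 * c = m * q)"
proof -
  have "2 * pi * c / m = (2 * of_int n + 1) * pi \<longleftrightarrow> 2 * int c = int m * (2 * n + 1)" for n :: int
  proof -
    have "2 * pi * c / m = (2 * of_int n + 1) * pi \<longleftrightarrow> 2 * real c = real m * (2 * of_int n + 1)"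
      using assms by (simp add: divide_eq_eq mult_ac)
    also have "\<dots> \<longleftrightarrow> real_of_int (2 * int c) = real_of_int (int m * (2 * n + 1))"
      by simp
    finally show ?thesis by (simp only: of_int_eq_iff)
  qed
  then have "cis (2 * pi * c / m) = - 1 \<longleftrightarrow> (\<exists>n. 2 * int c = int m * (2 * n + 1))"
    by (simp add: cis_eq_minus_one_iff)
  also have "\<dots> \<longleftrightarrow> (\<exists>q. odd q \<and> 2 * c = m * q)"
  proof
    assume "\<exists>n. 2 * int c = int m * (2 * n + 1)"
    then obtain n where n: "2 * int c = int m * (2 * n + 1)" by blast
    then have "0 \<le> int m * (2 * n + 1)" by (metis of_nat_0_le_iff zero_le_mult_iff zero_le_numeral)
    then have "0 \<le> 2 * n + 1" using assms by (simp add: zero_le_mult_iff)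
    then have "2 * int c = int (m * nat (2 * n + 1))" "odd (nat (2 * n + 1))"
      using n by (auto simp: even_nat_iff)
    then show "\<exists>q. odd q \<and> 2 * c = m * q"
      by (metis of_nat_eq_iff of_nat_mult of_nat_numeral)
  next
    assume "\<exists>q. odd q \<and> 2 * c = m * q"
    then obtain q where q: "odd q" "2 * c = m * q" by blast
    from \<open>odd q\<close> obtain k where "q = 2 * k + 1" by (rule oddE)
    with q have "2 * c = m * (2 * k + 1)" by simp
    then have "2 * int c = int m * (2 * int k + 1)"
      by (metis of_nat_1 of_nat_add of_nat_mult of_nat_numeral)
    then show "\<exists>n. 2 * int c = int m * (2 * n + 1)" by blast
  qed
  finally show ?thesis .
qed

lemma card_two_pick:
  assumes "card X = 2"
  shows "X = {pick X 0, pick X 1}" and "pick X 0 < pick X 1"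
proof -
  show less: "pick X 0 < pick X 1"
    using assms by (intro pick_mono_le) auto
  have "{pick X 0, pick X 1} \<subseteq> X"
    using pick_in_set_le[of 0 X] pick_in_set_le[of 1 X] assms by simp
  moreover have "card {pick X 0, pick X 1} = 2" using less by simp
  moreover have "finite X" using assms by (metis card.infinite zero_neq_numeral)
  ultimately show "X = {pick X 0, pick X 1}" using assms by (metis card_subset_eq)
qed

text \<open>
  The exponents on the two sides of the order-two criterion differ by
  \<open>(j1 * k1 + j2 * k2) - (j1 * k2 + j2 * k1) = (j2 - j1) * (k2 - k1)\<close>, so only the differences matter.
\<close>

lemma hadamard_fourier_submat_iff:
  fixes m j1 j2 k1 k2 :: nat
  assumes m: "m > 0" and J: "J = {j1, j2}" "j1 < j2" "j2 < m" and K: "K = {k1, k2}" "k1 < k2" "k2 < m"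
  shows "hadamard (fourier_submat m J K) \<longleftrightarrow>
    (\<exists>q. odd q \<and> 2 * ((j2 - j1) * (k2 - k1)) = m * q)"
proof -
  define e where "e c = cis (2 * pi * c / m)" for c :: nat
  define H where "H = fourier_submat m J K"
  have pick_pair: "pick {s, t} 0 = s" "pick {s, t} 1 = t" if "s < t" for s t
    using card_two_pick[of "{s, t}"] that by (auto simp: doubleton_eq_iff)
  have cards: "card {i. i < m \<and> i \<in> J} = 2" "card {i. i < m \<and> i \<in> K} = 2"
  proof -
    have "{i. i < m \<and> i \<in> J} = {j1, j2}" "{i. i < m \<and> i \<in> K} = {k1, k2}" using J K by auto
    then show "card {i. i < m \<and> i \<in> J} = 2" "card {i. i < m \<and> i \<in> K} = 2" using J K by auto
  qed
  have entry: "fourier_mat m $$ (j, k) = e (j * k)" if "j < m" "k < m" for j k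
    using that by (simp add: fourier_mat_def e_def cis_conv_exp mult_ac)
  have dims: "dim_row (fourier_mat m) = m" "dim_col (fourier_mat m) = m"
    by (simp_all add: fourier_mat_def)
  have carrier: "H \<in> carrier_mat 2 2"
    using cards by (auto simp: H_def fourier_submat_def dim_submatrix fourier_mat_def)
  have index: "H $$ (0, 0) = e (j1 * k1)" "H $$ (0, 1) = e (j1 * k2)"
      "H $$ (1, 0) = e (j2 * k1)" "H $$ (1, 1) = e (j2 * k2)"
    unfolding H_def fourier_submat_def
    using J(2,3) K(2,3) cards[unfolded J(1) K(1)] pick_pair[OF J(2)] pick_pair[OF K(2)]
    by (simp_all add: submatrix_index dims entry J(1) K(1) del: pick.simps One_nat_def insert_iff)
  have unimodular: "cmod (H $$ (i, j)) = 1" if "i < 2" "j < 2" for i j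
    using that index by (auto simp: less_2_cases_iff e_def)
  have factor: "e (j1 * k1) * e (j2 * k2) = e ((j2 - j1) * (k2 - k1)) * (e (j1 * k2) * e (j2 * k1))"
  proof -
    obtain a b where ab: "j2 = j1 + a" "k2 = k1 + b"
      using J K by (metis less_imp_add_positive)
    have e_add: "e s * e t = e (s + t)" for s t
      by (simp add: e_def cis_mult add_divide_distrib ring_distribs)
    have "j1 * k1 + (j1 + a) * (k1 + b) = a * b + (j1 * (k1 + b) + (j1 + a) * k1)"
      by (simp add: algebra_simps)
    then show ?thesis
      by (simp only: ab e_add diff_add_inverse)
  qed
  have "hadamard H \<longleftrightarrow> e (j1 * k1) * e (j2 * k2) = - (e (j1 * k2) * e (j2 * k1))"
    using hadamard_order_two_iff[OF carrier unimodular] by (simp only: index)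
  also have "\<dots> \<longleftrightarrow> e ((j2 - j1) * (k2 - k1)) = - 1"
  proof -
    have "e (j1 * k2) * e (j2 * k1) \<noteq> 0" by (simp add: e_def)
    then have "u * (e (j1 * k2) * e (j2 * k1)) = - (e (j1 * k2) * e (j2 * k1)) \<longleftrightarrow> u = - 1" for u
      by (metis mult_minus1 mult_right_cancel)
    then show ?thesis by (simp only: factor)
  qed
  also have "\<dots> \<longleftrightarrow> (\<exists>q. odd q \<and> 2 * ((j2 - j1) * (k2 - k1)) = m * q)"
    unfolding e_def by (rule cis_turn_eq_minus_one_iff[OF m])
  finally show ?thesis by (simp add: H_def)
qed

section \<open>Valuations and periods\<close>

text \<open>
  An odd cofactor \<open>q\<close> does not change the 2-adic valuation, which is therefore determined exactly,
  but it can raise the valuation at any other prime, where only an inequality remains.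
\<close>

lemma odd_multiple_iff:
  fixes m c :: nat
  assumes "m > 0" "c > 0"
  shows "(\<exists>q. odd q \<and> 2 * c = m * q) \<longleftrightarrow>
    multiplicity 2 m = multiplicity 2 c + 1 \<and>
    (\<forall>p. prime p \<and> odd p \<longrightarrow> multiplicity p m \<le> multiplicity p c)"
proof -
  have two_c: "multiplicity p (2 * c) = (if p = 2 then 1 else 0) + multiplicity p c"
    if "prime p" for p
  proof -
    have "multiplicity p (2 * c) = multiplicity p 2 + multiplicity p c"
      using that assms by (intro prime_elem_multiplicity_mult_distrib) auto
    also have "multiplicity p 2 = (if p = 2 then 1 else 0)"
      using that by (auto simp: prime_multiplicity_other two_is_prime_nat)
    finally show ?thesis .
  qed
  have mq: "multiplicity p (m * q) = multiplicity p m + multiplicity p q"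
    if "prime p" "q > 0" for p q
    using that assms by (intro prime_elem_multiplicity_mult_distrib) auto
  show ?thesis
  proof (intro iffI conjI allI impI)
    assume "\<exists>q. odd q \<and> 2 * c = m * q"
    then obtain q where q: "odd q" "2 * c = m * q" by blast
    then have "q > 0" by (auto intro: odd_pos)
    have eq: "(if p = 2 then 1 else 0) + multiplicity p c = multiplicity p m + multiplicity p q"
      if "prime p" for p
      using two_c[OF that] mq[OF that \<open>q > 0\<close>] q by simp
    show "multiplicity 2 m = multiplicity 2 c + 1"
      using eq[of 2] q by (simp add: not_dvd_imp_multiplicity_0)
    show "multiplicity p m \<le> multiplicity p c" if "prime p \<and> odd p" for p
      using eq[of p] that by (auto split: if_splits)
  next
    assume *: "multiplicity 2 m = multiplicity 2 c + 1 \<and>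
      (\<forall>p. prime p \<and> odd p \<longrightarrow> multiplicity p m \<le> multiplicity p c)"
    have "m dvd 2 * c"
    proof (rule multiplicity_le_imp_dvd)
      fix p :: nat assume p: "prime p"
      show "multiplicity p m \<le> multiplicity p (2 * c)"
      proof (cases "p = 2")
        case False
        then have "odd p" using p by (metis primes_dvd_imp_eq two_is_prime_nat)
        then show ?thesis using * p by (simp add: two_c)
      qed (use * p two_c in simp)
    qed (use assms in simp)
    then obtain q where q: "2 * c = m * q" by blast
    then have "q > 0" using assms by (auto intro: Nat.gr0I)
    then have "multiplicity 2 q = 0"
      using mq[of 2 q] two_c[of 2] q * by simp
    then have "odd q" using \<open>q > 0\<close> by (simp add: prime_elem_multiplicity_eq_zero_iff)
    then show "\<exists>q. odd q \<and> 2 * c = m * q" using q by blast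
  qed
qed

lemma multiplicity_div_gcd:
  fixes m a :: nat
  assumes "prime p" "m > 0" "a > 0"
  shows "multiplicity p (m div gcd m a) + min (multiplicity p m) (multiplicity p a) = multiplicity p m"
proof -
  have "multiplicity p (m div gcd m a * gcd m a) =
      multiplicity p (m div gcd m a) + multiplicity p (gcd m a)"
    using assms by (intro prime_elem_multiplicity_mult_distrib) (auto simp: dvd_div_eq_0_iff)
  then show ?thesis using assms by (simp add: multiplicity_gcd)
qed

text \<open>
  Since \<open>min \<mu> \<alpha> + min \<mu> \<beta>\<close> is \<open>\<alpha> + \<beta>\<close> unless one of \<open>\<alpha>, \<beta>\<close> exceeds \<open>\<mu>\<close>, in which case both sums are at
  least \<open>\<mu>\<close>, one sum reaches a given bound up to \<open>\<mu>\<close> exactly when the other does. The bounds \<open>\<mu>\<close>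
  and \<open>\<mu> - 1\<close> give the two equivalences.
\<close>

lemma period_multiplicities_iff:
  fixes m a b :: nat
  assumes "prime p" "m > 0" "a > 0" "b > 0"
  defines "s \<equiv> multiplicity p (m div gcd m a) + multiplicity p (m div gcd m b)"
  shows "s \<le> multiplicity p m \<longleftrightarrow> multiplicity p m \<le> multiplicity p (a * b)"
    and "s = multiplicity p m + 1 \<longleftrightarrow> multiplicity p m = multiplicity p (a * b) + 1"
proof -
  have "multiplicity p (a * b) = multiplicity p a + multiplicity p b"
    using assms by (intro prime_elem_multiplicity_mult_distrib) auto
  then show "s \<le> multiplicity p m \<longleftrightarrow> multiplicity p m \<le> multiplicity p (a * b)"
    and "s = multiplicity p m + 1 \<longleftrightarrow> multiplicity p m = multiplicity p (a * b) + 1"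
    using multiplicity_div_gcd[OF assms(1-3)] multiplicity_div_gcd[OF assms(1,2,4)]
    unfolding s_def by linarith+
qed

lemma period_set_doubleton:
  fixes m x y :: nat
  assumes "x < y" "y < m"
  shows "period_set m {x, y} - {1} = {int (m div gcd m (y - x))}"
proof -
  define a where "a = y - x"
  have a: "int y = int x + int a" "0 < a" "a < m" using assms by (auto simp: a_def)
  have "diff_set {x, y} = {0, int a, - int a}"
  proof -
    have "diff_set {x, y} = {int x - int x, int x - int y, int y - int x, int y - int y}"
      unfolding diff_set_def by blast
    then show ?thesis using a(1) by auto
  qed
  moreover have "period_set m {x, y} = (\<lambda>d. int m div gcd (int m) d) ` diff_set {x, y}"
    by (auto simp: period_set_def)
  ultimately have "period_set m {x, y} = {1, int (m div gcd m a)}"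
    using a by (simp add: zdiv_int)
  \<comment> \<open>A period 1 would require that \<open>m\<close> divides \<open>a\<close>, but \<open>0 < a < m\<close>.\<close>
  moreover have "m div gcd m a \<noteq> 1"
  proof
    assume "m div gcd m a = 1"
    then have "m = gcd m a" by (metis dvd_div_mult_self gcd_dvd1 mult_1)
    then show False using a by (metis gcd_le2_nat not_le less_not_refl2)
  qed
  ultimately show ?thesis by (auto simp: a_def)
qed

lemma multiplicity_int_int: "multiplicity (int p) (int n) = multiplicity p n"
  by (simp add: multiplicity_def flip: of_nat_power)

lemma nu_singleton:
  "nu_max p {int n} = multiplicity p n" "nu_min p {int n} = multiplicity p n"
  by (simp_all add: nu_max_def nu_min_def multiplicity_int_int)

section \<open>Hadamard submatrices of order two\<close>

theorem theorem3p5: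
  fixes m :: nat and J K :: "nat set"
  assumes "m > 0"
    and "J \<subseteq> {0..<m}" and "K \<subseteq> {0..<m}"
    and "card J = 2" and "card K = 2"
  shows "hadamard (fourier_submat m J K) \<longleftrightarrow>
    (nu_min 2 (period_set m J - {1}) + nu_min 2 (period_set m K - {1})
       = nu_max 2 (period_set m J - {1}) + nu_max 2 (period_set m K - {1})
     \<and> nu_max 2 (period_set m J - {1}) + nu_max 2 (period_set m K - {1})
       = multiplicity 2 m + 1)
    \<and> (\<forall>p::nat. prime p \<and> odd p \<longrightarrow>
         nu_max p (period_set m J - {1}) + nu_max p (period_set m K - {1})
           \<le> multiplicity p m)"
proof -
  obtain j1 j2 where J: "J = {j1, j2}" "j1 < j2" using card_two_pick[OF assms(4)] by blast
  obtain k1 k2 where K: "K = {k1, k2}" "k1 < k2" using card_two_pick[OF assms(5)] by blast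
  have lt: "j2 < m" "k2 < m" using J K assms(2,3) by auto
  define a b where "a = j2 - j1" and "b = k2 - k1"
  have pos: "a > 0" "b > 0" using J K by (auto simp: a_def b_def)
  have periods: "period_set m J - {1} = {int (m div gcd m a)}"
    "period_set m K - {1} = {int (m div gcd m b)}"
    using period_set_doubleton J K lt by (simp_all add: a_def b_def)
  have "hadamard (fourier_submat m J K) \<longleftrightarrow> (\<exists>q. odd q \<and> 2 * (a * b) = m * q)"
    using hadamard_fourier_submat_iff[OF assms(1) J lt(1) K lt(2)] by (simp add: a_def b_def)
  also have "\<dots> \<longleftrightarrow> multiplicity 2 m = multiplicity 2 (a * b) + 1 \<and>
      (\<forall>p. prime p \<and> odd p \<longrightarrow> multiplicity p m \<le> multiplicity p (a * b))"
    using assms(1) pos by (intro odd_multiple_iff) auto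
  also have "\<dots> \<longleftrightarrow>
      multiplicity 2 (m div gcd m a) + multiplicity 2 (m div gcd m b) = multiplicity 2 m + 1 \<and>
      (\<forall>p. prime p \<and> odd p \<longrightarrow>
        multiplicity p (m div gcd m a) + multiplicity p (m div gcd m b) \<le> multiplicity p m)"
    using period_multiplicities_iff[OF _ assms(1) pos] two_is_prime_nat by metis
  finally show ?thesis
    unfolding periods nu_singleton by simp
qed

end
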